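(* Let $G$ be a graph with girth $g\ge 6$ and maximum degree $\Delta\ge 3$. Then $\mu_2(G)\le 1+\Delta(\Delta-1)$.
   Context: All graphs are finite, simple, undirected and connected. The girth is the length of a shortest cycle. For a graph $G$, a set $S\subseteq V(G)$ and an integer $k\ge 1$, two vertices $x,y$ are $S_k$-visible if there is a shortest $x,y$-path of length at most $k$ none of whose internal vertices lies in $S$. $S$ is a $k$-distance mutual-visibility set if every two vertices of $S$ are $S_k$-visible, and $\mu_k(G)$ is the maximum cardinality of such a set. *)

theory Defs
  imports "Graph_Theory.Graph_Theory" "HOL-Library.Extended_Nat"
begin

text \<open>
  A finite simple undirected graph is rendered by the locale \<^locale>\<open>graph\<close> of Graph_Theory: a finite
  symmetric digraph without loops and without parallel arcs, so that an edge between u and v is a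
  pair of opposite arcs. The number of arcs leaving v is then the number of neighbours of v.
\<close>

definition max_degree :: "('a, 'b) pre_digraph \<Rightarrow> nat" where
  "max_degree G = Max (out_degree G ` verts G)"

text \<open>
  In a symmetric digraph \<^const>\<open>pre_digraph.cycle\<close> also admits the closed walks u, v, u that run
  along an edge and back; requiring length at least 3 leaves exactly the cycles of the
  undirected graph. The girth of an acyclic graph is \<open>\<infinity>\<close>.
\<close>

definition girth :: "('a, 'b) pre_digraph \<Rightarrow> enat" where
  "girth G = (INF p \<in> {p. pre_digraph.cycle G p \<and> 3 \<le> length p}. enat (length p))"

definition shortest_path :: "('a, 'b) pre_digraph \<Rightarrow> 'a \<Rightarrow> 'b awalk \<Rightarrow> 'a \<Rightarrow> bool" where
  "shortest_path G x p y \<longleftrightarrow>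
     pre_digraph.apath G x p y \<and> (\<forall>q. pre_digraph.apath G x q y \<longrightarrow> length p \<le> length q)"

definition visible :: "('a, 'b) pre_digraph \<Rightarrow> 'a set \<Rightarrow> nat \<Rightarrow> 'a \<Rightarrow> 'a \<Rightarrow> bool" where
  "visible G S k x y \<longleftrightarrow>
     (\<exists>p. shortest_path G x p y \<and> length p \<le> k \<and> set (pre_digraph.inner_verts G p) \<inter> S = {})"

definition mutual_visibility_set :: "('a, 'b) pre_digraph \<Rightarrow> nat \<Rightarrow> 'a set \<Rightarrow> bool" where
  "mutual_visibility_set G k S \<longleftrightarrow>
     S \<subseteq> verts G \<and> (\<forall>x\<in>S. \<forall>y\<in>S. x \<noteq> y \<longrightarrow> visible G S k x y)"

definition mutual_visibility_number :: "nat \<Rightarrow> ('a, 'b) pre_digraph \<Rightarrow> nat" where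
  "mutual_visibility_number k G = Max (card ` {S. mutual_visibility_set G k S})"

end

theory Submission
  imports Defs
begin

text \<open>
  If a set S of pairwise visible vertices contains an edge x y, then any third vertex of S closes a
  cycle of length at most 5 with it, so S has at most two elements. Otherwise all elements of S
  other than a fixed x lie at distance exactly 2 from x, and there are at most
  \<open>\<Delta> * (\<Delta> - 1)\<close> such vertices.
\<close>

text \<open>Walks of the library are lists of arcs, whereas short cycles are easiest to name by
  their vertices. Choosing one arc for each consecutive pair passes from the latter to the
  former.\<close>

lemma (in wf_digraph) successively_dominates_imp_awalk:
  assumes "vs \<noteq> []" "set vs \<subseteq> verts G" "successively (dominates G) vs"
  shows "\<exists>p. awalk (hd vs) p (last vs) \<and> awalk_verts (hd vs) p = vs"
  using assms
proof (induction vs rule: induct_list012)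
  case (2 x)
  then show ?case by (intro exI[of _ "[]"]) (simp add: awalk_Nil_iff)
next
  case (3 x y zs)
  then obtain p where p: "awalk y p (last (y # zs))" "awalk_verts y p = y # zs"
    by auto
  from 3 obtain e where "e \<in> arcs G" "tail G e = x" "head G e = y"
    by auto
  with p show ?case by (intro exI[of _ "e # p"]) (simp add: awalk_Cons_iff)
qed simp

text \<open>The closed walk is started at \<open>last vs\<close>: its vertex sequence is then
  \<open>last vs # vs\<close>, whose tail, required to be distinct in a cycle, is \<open>vs\<close>
  itself.\<close>

lemma (in wf_digraph) girth_le:
  assumes "3 \<le> length vs" "distinct vs" "successively (dominates G) vs" "last vs \<rightarrow> hd vs"
  shows "girth G \<le> enat (length vs)"
proof -
  from assms(1) have ne: "vs \<noteq> []" by auto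
  have "successively (dominates G) (last vs # vs)"
    using assms(3,4) ne by (cases vs) simp_all
  moreover have "set (last vs # vs) \<subseteq> verts G"
  proof
    fix u assume "u \<in> set (last vs # vs)"
    with ne obtain as bs where vs: "vs = as @ u # bs"
      using split_list[of u vs] by auto
    \<comment> \<open>With \<open>last vs\<close> prepended, every element of \<open>vs\<close> has
      a predecessor dominating it and is therefore a vertex.\<close>
    then have "successively (dominates G) ((last vs # as) @ u # bs)"
      using calculation by simp
    then have "last (last vs # as) \<rightarrow> u"
      unfolding successively_append_iff by simp
    then show "u \<in> verts G" by (rule adj_in_verts)
  qed
  ultimately obtain p where p: "awalk (last vs) p (last vs)" "awalk_verts (last vs) p = last vs # vs"
    using successively_dominates_imp_awalk[of "last vs # vs"] ne by auto
  have len: "length p = length vs"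
    using p(2) length_awalk_verts[of "last vs" p] by simp
  have "cycle p"
    unfolding cycle_def using p assms(2) len ne by (intro exI[of _ "last vs"]) auto
  then show ?thesis
    unfolding girth_def using len assms(1) by (intro INF_lower2[of p]) auto
qed

lemma visible_2_cases:
  assumes "visible G S 2 x y" "x \<noteq> y"
  obtains "x \<rightarrow>\<^bsub>G\<^esub> y" | w where "w \<notin> S" "x \<rightarrow>\<^bsub>G\<^esub> w" "w \<rightarrow>\<^bsub>G\<^esub> y"
proof -
  from assms(1) obtain p where p: "pre_digraph.awalk G x p y" "length p \<le> 2"
    "set (pre_digraph.inner_verts G p) \<inter> S = {}"
    by (auto simp: visible_def shortest_path_def pre_digraph.apath_def)
  have arcs: "set p \<subseteq> arcs G" and cas: "pre_digraph.cas G x p y"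
    using p(1) by (auto simp: pre_digraph.awalk_def)
  consider "p = []" | a where "p = [a]" | a b where "p = [a, b]"
    using p(2) by (cases p; cases "tl p"; cases "tl (tl p)") auto
  then show thesis
  proof cases
    case 1
    then show thesis using cas assms(2) by (simp add: pre_digraph.cas.simps)
  next
    case 2
    then show thesis using cas arcs that(1)
      by (auto simp: pre_digraph.cas.simps arcs_ends_conv)
  next
    case 3
    \<comment> \<open>The single inner vertex of \<open>[a, b]\<close> is \<open>tail G b\<close>,
      which equals \<open>head G a\<close>.\<close>
    then show thesis using cas arcs p(3) that(2)[of "tail G b"]
      by (auto simp: pre_digraph.cas.simps pre_digraph.inner_verts_def arcs_ends_conv rev_image_eqI)
  qed
qed

context graph
begin

lemma dominates_sym: "u \<rightarrow> v \<Longrightarrow> v \<rightarrow> u"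
  using sym_arcs by (rule arcs_ends_symmetric)

lemma card_mutual_visibility_set_2_le_2:
  assumes g: "girth G \<ge> 6" and S: "mutual_visibility_set G 2 S"
    and xy: "x \<in> S" "y \<in> S" "x \<rightarrow> y"
  shows "card S \<le> 2"
proof -
  have vis: "visible G S 2 u v" if "u \<in> S" "v \<in> S" "u \<noteq> v" for u v
    using S that by (auto simp: mutual_visibility_set_def)
  have no_cycle: "\<not> last vs \<rightarrow> hd vs"
    if "3 \<le> length vs" "length vs \<le> 5" "distinct vs" "successively (dominates G) vs" for vs
  proof
    assume "last vs \<rightarrow> hd vs"
    from order_trans[OF g girth_le[OF that(1,3,4) this]] that(2) show False
      by (simp add: numeral_eq_enat)
  qed
  have C3: False if "a \<rightarrow> b" "b \<rightarrow> c" "c \<rightarrow> a" for a b c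
    using no_cycle[of "[a, b, c]"] that adj_not_same by auto
  have C4: False if "a \<rightarrow> b" "b \<rightarrow> c" "c \<rightarrow> d" "d \<rightarrow> a" "a \<noteq> c" "b \<noteq> d" for a b c d
    using no_cycle[of "[a, b, c, d]"] that adj_not_same by auto
  \<comment> \<open>If two non-consecutive vertices coincided, three of the five arcs would form a
    triangle; so \<open>C3\<close> and the absence of loops already make the five vertices
    distinct.\<close>
  have C5: False if "a \<rightarrow> b" "b \<rightarrow> c" "c \<rightarrow> d" "d \<rightarrow> e" "e \<rightarrow> a" for a b c d e
    using no_cycle[of "[a, b, c, d, e]"] that adj_not_same C3 by auto
  have no_nbr: False if "u \<in> S" "v \<in> S" "z \<in> S" "u \<rightarrow> v" "z \<noteq> v" "z \<rightarrow> u" for u v z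
    using vis[OF that(3,2,5)] that(5)
  proof (cases rule: visible_2_cases)
    case 1
    then show False using C3[of z v u] that dominates_sym by blast
  next
    \<comment> \<open>Visibility enters here: \<open>w\<close> lies outside \<open>S\<close> and
      \<open>u\<close> inside, so \<open>w\<close> differs from \<open>u\<close> and the 4-cycle
      \<open>z\<close>, \<open>w\<close>, \<open>v\<close>, \<open>u\<close> is genuine.\<close>
    case (2 w)
    then show False using C4[of z w v u] that dominates_sym by blast
  qed
  have "z \<in> {x, y}" if z: "z \<in> S" for z
  proof (rule ccontr)
    assume "z \<notin> {x, y}"
    then have ne: "z \<noteq> x" "z \<noteq> y" by auto
    have yx: "y \<rightarrow> x" using xy(3) by (rule dominates_sym)
    have "\<not> z \<rightarrow> x" "\<not> z \<rightarrow> y"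
      using no_nbr[OF xy(1,2) z xy(3)] no_nbr[OF xy(2,1) z yx] ne by auto
    \<comment> \<open>As \<open>z\<close> is adjacent to neither end of the edge, it reaches both
      through middle vertices, closing the pentagon \<open>z\<close>, \<open>w\<close>,
      \<open>x\<close>, \<open>y\<close>, \<open>w'\<close>. The case \<open>w = w'\<close> is
      covered by \<open>C5\<close>.\<close>
    with vis[OF z xy(1) ne(1)] vis[OF z xy(2) ne(2)] ne
    obtain w w' where "z \<rightarrow> w" "w \<rightarrow> x" "z \<rightarrow> w'" "w' \<rightarrow> y"
      by (metis visible_2_cases)
    then show False using C5[of z w x y w'] xy(3) dominates_sym by blast
  qed
  then have "S \<subseteq> {x, y}" by blast
  then have "card S \<le> card {x, y}" by (intro card_mono) auto
  also have "\<dots> \<le> 2" by (simp add: card_insert_if)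
  finally show ?thesis .
qed

lemma out_degree_le_max_degree:
  assumes "v \<in> verts G"
  shows "out_degree G v \<le> max_degree G"
  unfolding max_degree_def using assms by (intro Max_ge) auto

text \<open>There are at most \<Delta> choices for the middle vertex \<open>w\<close>, and each
  \<open>w\<close> has at most \<Delta> - 1 neighbours besides \<open>x\<close>, since
  \<open>x\<close> is itself a neighbour of \<open>w\<close>.\<close>

lemma card_distance_two_le:
  assumes x: "x \<in> verts G" and T: "\<And>z. z \<in> T \<Longrightarrow> z \<noteq> x \<and> (\<exists>w. x \<rightarrow> w \<and> w \<rightarrow> z)"
  shows "card T \<le> max_degree G * (max_degree G - 1)"
proof -
  let ?N = "\<lambda>a. head G ` out_arcs G (head G a) - {x}"
  have "T \<subseteq> (\<Union>a\<in>out_arcs G x. ?N a)"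
  proof
    fix z assume "z \<in> T"
    with T obtain w where "z \<noteq> x" "x \<rightarrow> w" "w \<rightarrow> z" by blast
    then show "z \<in> (\<Union>a\<in>out_arcs G x. ?N a)"
      by (fastforce simp: arcs_ends_conv)
  qed
  then have "card T \<le> card (\<Union>a\<in>out_arcs G x. ?N a)"
    by (intro card_mono finite_UN_I finite_Diff finite_imageI finite_out_arcs)
  also have "\<dots> \<le> (\<Sum>a\<in>out_arcs G x. card (?N a))"
    by (intro card_UN_le finite_out_arcs)
  also have "\<dots> \<le> (\<Sum>a\<in>out_arcs G x. max_degree G - 1)"
  proof (rule sum_mono)
    fix a assume a: "a \<in> out_arcs G x"
    then have "x \<rightarrow> head G a" by (auto simp: arcs_ends_conv)
    then have "head G a \<rightarrow> x" by (rule dominates_sym)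
    \<comment> \<open>Because \<open>x\<close> is among these heads, removing it lowers the
      cardinality by exactly one; this is the source of the factor \<Delta> - 1.\<close>
    then have "x \<in> head G ` out_arcs G (head G a)" by (force simp: arcs_ends_conv)
    then have "card (?N a) = card (head G ` out_arcs G (head G a)) - 1" by simp
    also have "\<dots> \<le> out_degree G (head G a) - 1"
      unfolding out_degree_def by (intro diff_le_mono card_image_le finite_out_arcs)
    also have "\<dots> \<le> max_degree G - 1"
      using a by (intro diff_le_mono out_degree_le_max_degree) auto
    finally show "card (?N a) \<le> max_degree G - 1" .
  qed
  also have "\<dots> = out_degree G x * (max_degree G - 1)"
    by (simp add: out_degree_def)
  also have "\<dots> \<le> max_degree G * (max_degree G - 1)"
    using x by (intro mult_right_mono out_degree_le_max_degree) auto
  finally show ?thesis .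
qed

lemma card_mutual_visibility_set_2_le:
  assumes "girth G \<ge> 6" "max_degree G \<ge> 2" and S: "mutual_visibility_set G 2 S"
  shows "card S \<le> 1 + max_degree G * (max_degree G - 1)"
proof (cases "\<exists>x\<in>S. \<exists>y\<in>S. x \<rightarrow> y")
  case True
  then have "card S \<le> 2" using card_mutual_visibility_set_2_le_2 assms by blast
  also have "2 \<le> 1 + max_degree G * (max_degree G - 1)"
    using assms(2) by auto
  finally show ?thesis .
next
  case indep: False
  show ?thesis
  proof (cases "S = {}")
    case False
    then obtain x where x: "x \<in> S" by blast
    have "\<exists>w. x \<rightarrow> w \<and> w \<rightarrow> z" if "z \<in> S - {x}" for z
    proof -
      have "visible G S 2 x z" "x \<noteq> z"
        using S x that by (auto simp: mutual_visibility_set_def)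
      \<comment> \<open>Independence of \<open>S\<close> rules out the single arc, leaving a common
        neighbour of \<open>x\<close> and \<open>z\<close>. The summand 1 in the bound accounts for
        \<open>x\<close>.\<close>
      then show ?thesis using indep x that by (cases rule: visible_2_cases) auto
    qed
    then have "card (S - {x}) \<le> max_degree G * (max_degree G - 1)"
      using S x by (intro card_distance_two_le[of x]) (auto simp: mutual_visibility_set_def)
    moreover have "finite S"
      using S finite_verts by (auto simp: mutual_visibility_set_def intro: finite_subset)
    ultimately show ?thesis using card_Suc_Diff1[OF _ x] by simp
  qed simp
qed

end

theorem theorem5p2:
  fixes G :: "('a, 'b) pre_digraph" and \<Delta> :: nat
  assumes "graph G" and "connected G"
    and "girth G \<ge> 6"
    and "\<Delta> = max_degree G" and "\<Delta> \<ge> 3"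
  shows "mutual_visibility_number 2 G \<le> 1 + \<Delta> * (\<Delta> - 1)"
proof -
  interpret graph G by fact
  \<comment> \<open>\<open>Max\<close> is meaningful only for a finite nonempty set: finiteness
    comes from the power set, nonemptiness from the empty visibility set.\<close>
  have "{S. mutual_visibility_set G 2 S} \<subseteq> Pow (verts G)"
    by (auto simp: mutual_visibility_set_def)
  then have "finite {S. mutual_visibility_set G 2 S}"
    by (rule finite_subset) simp
  moreover have "mutual_visibility_set G 2 {}"
    by (simp add: mutual_visibility_set_def)
  ultimately show ?thesis
    unfolding mutual_visibility_number_def
    using card_mutual_visibility_set_2_le assms by (subst Max_le_iff) auto
qed

end
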